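(* Let $\lambda=\frac{d-1}{2}$ be a positive integer or half-integer (i.e. $d\ge 2$ is an integer). Then for every integer $n\geq 0$ the kernel $L_n^\lambda$ satisfies the following estimates: $$L_n^\lambda(\cos\vartheta)\leq D_\lambda\,\frac{C^{\lfloor\lambda\rfloor}}{B_n^\lambda\,\left(\sin\frac{\vartheta}{2}\right)^{2\lambda+2}}\binom{n+2\lambda}{n}\qquad\text{for } 0<\vartheta\leq\pi,$$ and $$L_n^\lambda(\cos\vartheta)\leq\frac{1}{B_n^\lambda}\sum_{\ell=0}^{2\lambda+2}\binom{2\lambda+2}{\ell}2^{2\lambda+2-\ell}(-1)^\ell\binom{n+4\lambda+2-\ell}{n}\qquad\text{for } 0\leq\vartheta\leq\pi,$$ where $D_\lambda=2$ for $\lambda\in\mathbb{N}$ and $D_\lambda=4$ if $\lambda\in\frac12+\mathbb{N}_0$.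
   Context: For $\lambda>0$, $C_k^\lambda$ denotes the $k$-th Gegenbauer polynomial of index $\lambda$, given by $\sum_{k=0}^\infty C_k^\lambda(\cos\vartheta)z^k=(1-2z\cos\vartheta+z^2)^{-\lambda}$. The numbers $B_n^\lambda$ are defined by the generating function $$\sum_{n=0}^\infty B_n^\lambda z^n=\frac{(1+z)^{2\lambda+1}}{(1-z)^{2\lambda+2}},$$ and the kernel $L_n^\lambda$ is defined by $$L_n^\lambda(t)=\frac{1}{B_n^\lambda}\sum_{k=0}^n B_{n-k}^\lambda\,\frac{k+\lambda}{\lambda}\,C_k^\lambda(t),$$ equivalently $$\sum_{n\ge0}B_n^\lambda L_n^\lambda(\cos\vartheta)z^n=\frac{(1+z)^{2\lambda+2}}{(1-2z\cos\vartheta+z^2)^{\lambda+1}(1-z)^{2\lambda+1}}.$$ The constant $C$ (without indices; $C^{\lfloor\lambda\rfloor}$ is its $\lfloor\lambda\rfloor$-th power, not a Gegenbauer polynomial) is $C=1+C'$, where $-C'=\min_{t\in\mathbb{R}}\frac{\sin t}{t}$ (with value $1$ at $t=0$), so $C'=0.2172336282\ldots$ and $C=1.2172336282\ldots$. Here $d$ is the dimension of the sphere $\mathbb{S}^d\subset\mathbb{R}^{d+1}$ and $\lambda=\frac{d-1}{2}$ is the corresponding Gegenbauer parameter; "half-integer" means an element of $\frac12+\mathbb{Z}$, so $\lambda\in\{\frac12,1,\frac32,2,\dots\}$. $\mathbb{N}=\{1,2,\dots\}$, $\mathbb{N}_0=\{0,1,2,\dots\}$, and $\lfloor\cdot\rfloor$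 is the floor function. *)

theory Defs
  imports "HOL-Probability.Sinc_Integral"
begin

text \<open>
  The generating functions are read as formal power series over the reals. For \<open>f\<close> with constant
  term 1, the real power of \<open>f\<close> with exponent \<open>a\<close> is the binomial series
  \<open>\<Sum>k. (a gchoose k) * (f - 1) ^ k\<close>. (The composition is only meaningful if \<open>f - 1\<close> has constant
  term 0.)
\<close>

definition fps_real_power :: "real fps \<Rightarrow> real \<Rightarrow> real fps" where
  "fps_real_power f a = fps_binomial a oo (f - 1)"

lemma fps_real_power_of_nat:
  assumes "fps_nth f 0 = 1"
  shows "fps_real_power f (real m) = f ^ m"
proof -
  have z: "fps_nth (f - 1) 0 = 0"
    using assms by simp
  have "(1 + fps_X) oo (f - 1) = f"
    using z by (simp add: fps_compose_add_distrib)
  then show ?thesis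
    using fps_compose_power[OF z, of "1 + fps_X" m]
    by (simp add: fps_real_power_def fps_binomial_of_nat)
qed

lemma fps_real_power_add:
  assumes "fps_nth f 0 = 1"
  shows "fps_real_power f (a + b) = fps_real_power f a * fps_real_power f b"
  using assms
  by (simp add: fps_real_power_def fps_binomial_add_mult fps_compose_mult_distrib)

definition gegenbauer :: "real \<Rightarrow> nat \<Rightarrow> real \<Rightarrow> real" where
  "gegenbauer l k t =
     fps_nth (fps_real_power (1 - fps_const (2 * t) * fps_X + fps_X\<^sup>2) (- l)) k"

definition B_coeff :: "real \<Rightarrow> nat \<Rightarrow> real" where
  "B_coeff l n =
     fps_nth (fps_real_power (1 + fps_X) (2 * l + 1) / fps_real_power (1 - fps_X) (2 * l + 2)) n"

definition L_kernel :: "real \<Rightarrow> nat \<Rightarrow> real \<Rightarrow> real" where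
  "L_kernel l n t =
     1 / B_coeff l n * (\<Sum>k=0..n. B_coeff l (n - k) * ((real k + l) / l) * gegenbauer l k t)"

text \<open>
  Here \<open>sinc\<close> is the function \<open>sin t / t\<close> with value 1 at 0; its infimum is a minimum
  by \<open>sinc_attains_Inf\<close>.
\<close>

definition C'_const :: real where
  "C'_const = - (INF t. sinc t)"

definition C_const :: real where
  "C_const = 1 + C'_const"

definition D_const :: "real \<Rightarrow> real" where
  "D_const l = (if l \<in> \<nat> then 2 else 4)"

lemma sinc_attains_Inf: "\<exists>s. sinc s = (INF t. sinc t) \<and> (\<forall>t. sinc s \<le> sinc t)"
proof -
  define g :: "real \<Rightarrow> real" where "g = sinc"
  define r :: real where "r = 3 * pi / 2"
  have r: "r > 0"
    by (simp add: r_def)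
  have gr: "g r = - 1 / r"
    using sin_3over2_pi r by (simp add: g_def r_def)
  have cont: "continuous_on {-r..r} g"
    unfolding g_def by (intro continuous_at_imp_continuous_on ballI isCont_sinc)
  have "\<exists>s\<in>{-r..r}. \<forall>t\<in>{-r..r}. g s \<le> g t"
    by (rule continuous_attains_inf[OF _ _ cont]) (use r in auto)
  then obtain s where s: "\<And>t. t \<in> {-r..r} \<Longrightarrow> g s \<le> g t"
    by blast
  have min: "g s \<le> g t" for t
  proof (cases "t \<in> {-r..r}")
    case True
    then show ?thesis by (rule s)
  next
    case False
    then have t: "\<bar>t\<bar> > r" by auto
    then have "t \<noteq> 0" using r by auto
    then have "\<bar>g t\<bar> = \<bar>sin t\<bar> / \<bar>t\<bar>"
      by (simp add: g_def)
    also have "\<dots> \<le> 1 / r"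
      using t r by (intro frac_le) auto
    finally have "g r \<le> g t"
      unfolding gr by linarith
    moreover have "g s \<le> g r"
      using r by (intro s) auto
    ultimately show ?thesis by linarith
  qed
  have "Inf (range g) = g s"
    by (rule cInf_eq_minimum) (use min in blast)+
  then have "g s = (INF t. g t) \<and> (\<forall>t. g s \<le> g t)"
    using min by simp
  then show ?thesis
    unfolding g_def by (rule exI)
qed

end

theory Submission
  imports Defs
begin

text \<open>
  Put \<open>A = 1 - 2 z cos \<theta> + z\<^sup>2\<close>, \<open>s = sin\<^sup>2 (\<theta> / 2)\<close> and \<open>c = cos\<^sup>2 (\<theta> / 2)\<close>. The kernel has the generating
  function \<open>(1 + z) ^ (d + 1) * A powr (- (d + 1) / 2) * (1 - z) ^ (- d)\<close>.

  For the second bound, the coefficients of \<open>A powr (- 1 / 2)\<close> are bounded by 1 in absolute value, hence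
  \<open>A powr (- 1 / 2)\<close> is majorized by \<open>1 / (1 - z)\<close>, its value at \<open>\<theta> = 0\<close>.

  For the first bound, the identity \<open>s (1 + z)\<^sup>2 + c (1 - z)\<^sup>2 = A\<close> gives
  \<open>s (1 + z)\<^sup>2 / A = 1 - c (1 - z)\<^sup>2 / A\<close>. Divided by \<open>(1 - z)\<^sup>2\<close> this has coefficients between 0 and
  \<open>C (n + 1)\<close>, divided by \<open>1 - z\<close> it has coefficients between 0 and 2. For half-integral \<open>l\<close> the square root
  of this factor is left over. It is an average of such factors over other angles: by the Poisson kernel,
  \<open>1 / sqrt (A B)\<close> is the mean of \<open>1 / (A cos\<^sup>2 \<psi> + B sin\<^sup>2 \<psi>)\<close>, used with \<open>B = (1 + z)\<^sup>2\<close>. Taking \<open>N\<close>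
  equidistant nodes makes this exact up to order \<open>N\<close>.
\<close>

section \<open>Majorization of power series\<close>

definition fps_majorized :: "real fps \<Rightarrow> real fps \<Rightarrow> bool" where
  "fps_majorized f g \<longleftrightarrow> (\<forall>n. \<bar>fps_nth f n\<bar> \<le> fps_nth g n)"

lemma fps_majorized_nonneg: "fps_majorized f g \<Longrightarrow> 0 \<le> fps_nth g n"
  unfolding fps_majorized_def by (metis abs_ge_zero order_trans)

lemma fps_majorized_nthD: "fps_majorized f g \<Longrightarrow> fps_nth f n \<le> fps_nth g n"
  unfolding fps_majorized_def by (meson abs_le_D1)

lemma fps_majorized_mult:
  assumes "fps_majorized f g" "fps_majorized h k"
  shows "fps_majorized (f * h) (g * k)"
  unfolding fps_majorized_def
proof
  fix n
  have "\<bar>fps_nth (f * h) n\<bar> \<le> (\<Sum>i=0..n. \<bar>fps_nth f i * fps_nth h (n - i)\<bar>)"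
    unfolding fps_mult_nth by (rule sum_abs)
  also have "\<dots> \<le> (\<Sum>i=0..n. fps_nth g i * fps_nth k (n - i))"
    using assms unfolding abs_mult
    by (intro sum_mono mult_mono) (auto simp: fps_majorized_def intro: fps_majorized_nonneg)
  finally show "\<bar>fps_nth (f * h) n\<bar> \<le> fps_nth (g * k) n"
    by (simp add: fps_mult_nth)
qed

lemma fps_majorized_one: "fps_majorized 1 1"
  by (simp add: fps_majorized_def)

lemma fps_majorized_power: "fps_majorized f g \<Longrightarrow> fps_majorized (f ^ k) (g ^ k)"
  by (induction k) (auto intro: fps_majorized_mult fps_majorized_one)

lemma fps_majorized_refl: "(\<And>n. 0 \<le> fps_nth f n) \<Longrightarrow> fps_majorized f f"
  by (simp add: fps_majorized_def)

lemma fps_power_nonneg: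
  fixes f :: "real fps"
  assumes "\<And>n. 0 \<le> fps_nth f n"
  shows "0 \<le> fps_nth (f ^ k) n"
  using fps_majorized_nonneg fps_majorized_power fps_majorized_refl assms by blast

text \<open>One-sided counterpart of majorization: \<open>g\<close> may have coefficients of any
  sign. It serves factors that are bounded only from above.\<close>

lemma fps_mult_left_mono:
  fixes f g h :: "real fps"
  assumes "\<And>n. 0 \<le> fps_nth f n" "\<And>n. fps_nth g n \<le> fps_nth h n"
  shows "fps_nth (f * g) n \<le> fps_nth (f * h) n"
  unfolding fps_mult_nth using assms by (intro sum_mono mult_left_mono) auto

section \<open>Powers of the geometric series\<close>

abbreviation geometric_fps :: "real fps" where
  "geometric_fps \<equiv> inverse (1 - fps_X)"

lemma geometric_fps_mult: "geometric_fps * (1 - fps_X) = 1"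
  by (simp add: inverse_mult_eq_1)

lemma geometric_fps_nth: "fps_nth geometric_fps n = 1"
  by (simp add: fps_inverse_one_minus_fps_X)

lemma geometric_fps_power_nth:
  "fps_nth (geometric_fps ^ Suc k) n = real ((n + k) choose n)"
proof -
  have "geometric_fps ^ Suc k = inverse ((1 - fps_const 1 * fps_X) ^ Suc k)"
    by (simp add: fps_inverse_power del: power_Suc)
  also have "\<dots> = Abs_fps (\<lambda>i. real ((Suc k + i - 1) choose i))"
    by (subst one_minus_const_fps_X_neg_power') simp_all
  finally show ?thesis
    by (simp add: add.commute)
qed

lemma geometric_fps_squared_nth: "fps_nth (geometric_fps\<^sup>2) n = real (Suc n)"
  using geometric_fps_power_nth[of 1 n] by (simp add: power2_eq_square)

lemma one_plus_fps_X_power_nth_nonneg: "0 \<le> fps_nth ((1 + fps_X :: real fps) ^ k) n"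
  by (rule fps_power_nonneg) (simp add: fps_X_def)

section \<open>The quadratic A and its inverse square root\<close>

definition quad_fps :: "real \<Rightarrow> real fps" where
  "quad_fps t = 1 - fps_const (2 * t) * fps_X + fps_X\<^sup>2"

lemma quad_fps_alt: "quad_fps t = 1 - 2 * fps_const t * fps_X + fps_X\<^sup>2"
  by (simp add: quad_fps_def numeral_fps_const flip: fps_const_mult)

text \<open>Turns an identity \<open>f * quad_fps t = h\<close> into a three-term recurrence with
  two initial values, so that closed forms of coefficients follow from addition theorems.\<close>

lemma mult_quad_fps_nth:
  "fps_nth (f * quad_fps t) 0 = fps_nth f 0"
  "fps_nth (f * quad_fps t) (Suc 0) = fps_nth f 1 - 2 * t * fps_nth f 0"
  "fps_nth (f * quad_fps t) (Suc (Suc n)) =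
     fps_nth f (Suc (Suc n)) - 2 * t * fps_nth f (Suc n) + fps_nth f n"
proof -
  have "f * quad_fps t = f - fps_const (2 * t) * (fps_X * f) + fps_X * (fps_X * f)"
    by (simp add: quad_fps_def algebra_simps power2_eq_square)
  then show "fps_nth (f * quad_fps t) 0 = fps_nth f 0"
    "fps_nth (f * quad_fps t) (Suc 0) = fps_nth f 1 - 2 * t * fps_nth f 0"
    "fps_nth (f * quad_fps t) (Suc (Suc n)) =
       fps_nth f (Suc (Suc n)) - 2 * t * fps_nth f (Suc n) + fps_nth f n"
    by simp_all
qed

lemma quad_fps_nth:
  "fps_nth (quad_fps t) 0 = 1"
  "fps_nth (quad_fps t) (Suc 0) = - 2 * t"
  "fps_nth (quad_fps t) (Suc (Suc n)) = (if n = 0 then 1 else 0)"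
  by (simp_all add: quad_fps_def power2_eq_square)

lemmas quad_fps_nth_0 = quad_fps_nth(1)

text \<open>Every exponent of A that occurs is a multiple of 1/2, so powers of this one series
  suffice.\<close>

definition quad_rsqrt :: "real \<Rightarrow> real fps" where
  "quad_rsqrt t = fps_real_power (quad_fps t) (- 1 / 2)"

lemma quad_rsqrt_nth_0: "fps_nth (quad_rsqrt t) 0 = 1"
  by (simp add: quad_rsqrt_def fps_real_power_def)

lemma fps_real_power_half_integer:
  assumes "fps_nth f 0 = 1"
  shows "fps_real_power f (- (real k / 2)) = fps_real_power f (- 1 / 2) ^ k"
proof (induction k)
  case 0
  then show ?case by (simp add: fps_real_power_def)
next
  case (Suc k)
  have "- (real (Suc k) / 2) = - 1 / 2 + - (real k / 2)"
    by (simp add: field_simps)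
  then show ?case
    using fps_real_power_add[OF assms, of "- 1 / 2" "- (real k / 2)"] Suc by simp
qed

lemma quad_rsqrt_squared: "(quad_rsqrt t)\<^sup>2 * quad_fps t = 1"
proof -
  have "fps_real_power (quad_fps t) (- 1 / 2 + (- 1 / 2) + real 1) = (quad_rsqrt t)\<^sup>2 * quad_fps t"
    by (simp only: fps_real_power_add quad_fps_nth_0 fps_real_power_of_nat quad_rsqrt_def
        power2_eq_square power_one_right)
  then show ?thesis by (simp add: fps_real_power_def)
qed

text \<open>The product rule applied to g^2 A = 1 gives 2 g g' A + g^2 A' = 0; multiplying by g and
  using g^2 A = 1 again isolates g'. No chain rule for real powers is involved.\<close>

lemma quad_rsqrt_deriv:
  "fps_deriv (quad_rsqrt t) = quad_rsqrt t ^ 3 * (fps_const t - fps_X)"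
proof -
  let ?g = "quad_rsqrt t" and ?A = "quad_fps t"
  have A': "fps_deriv ?A = 2 * (fps_X - fps_const t)"
    by (simp add: quad_fps_alt power2_eq_square algebra_simps numeral_fps_const)
  have "fps_deriv (?g\<^sup>2 * ?A) = 0"
    by (simp add: quad_rsqrt_squared)
  then have *: "2 * ?g * fps_deriv ?g * ?A + ?g\<^sup>2 * (2 * (fps_X - fps_const t)) = 0"
    by (simp add: A' power2_eq_square algebra_simps)
  have "2 * (fps_deriv ?g - ?g ^ 3 * (fps_const t - fps_X)) = 0"
    using * quad_rsqrt_squared[of t] by algebra
  then show ?thesis by simp
qed

section \<open>Generating functions of the Gegenbauer polynomials, of \<open>B_coeff\<close> and of
  the kernel\<close>

lemma gegenbauer_fps:
  assumes "d \<ge> 2"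
  shows "Abs_fps (\<lambda>k. (real k + (real d - 1) / 2) / ((real d - 1) / 2) *
            gegenbauer ((real d - 1) / 2) k t) = quad_rsqrt t ^ (d + 1) * (1 - fps_X\<^sup>2)"
proof -
  let ?g = "quad_rsqrt t" and ?l = "(real d - 1) / 2"
  obtain e where d: "d = Suc (Suc e)"
    using assms by (metis Suc_le_D numeral_2_eq_2 Suc_le_mono)
  have l: "?l > 0" using assms by simp
  have "gegenbauer ?l k t = fps_nth (?g ^ Suc e) k" for k
    using fps_real_power_half_integer[OF quad_fps_nth_0, of t "Suc e"]
    by (simp add: gegenbauer_def quad_rsqrt_def d flip: quad_fps_def)
  \<comment> \<open>Multiplying the k-th coefficient by (k + l) / l is the operator 1 + (1 / l) z
    d/dz.\<close>
  then have "Abs_fps (\<lambda>k. (real k + ?l) / ?l * gegenbauer ?l k t)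
      = ?g ^ Suc e + fps_const (1 / ?l) * (fps_X * fps_deriv (?g ^ Suc e))"
    using l by (intro fps_ext) (simp add: fps_mult_fps_X_deriv_shift field_simps del: power_Suc)
  also have "fps_deriv (?g ^ Suc e) = fps_const (real (Suc e)) * (?g ^ (e
      + 3) * (fps_const t - fps_X))"
    unfolding fps_deriv_power by (simp add: quad_rsqrt_deriv power_add mult_ac)
  also have "fps_const (1 / ?l) * (fps_X * (fps_const (real (Suc e)) * (?g ^ (e
      + 3) * (fps_const t - fps_X))))
     = 2 * (fps_X * (?g ^ (e + 3) * (fps_const t - fps_X)))"
  proof -
    have "fps_const (1 / ?l) * fps_const (real (Suc e)) = 2"
      using l by (simp add: d numeral_fps_const field_simps)
    moreover have "a * (x * (b * y)) = a * b * (x * y)" for a b x y :: "real fps"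
      by (simp only: mult_ac)
    ultimately show ?thesis by metis
  qed
  \<comment> \<open>\<open>?g ^ Suc e\<close> is A times \<open>?g ^ (e + 3)\<close>, and A + 2 z (t
    - z) = 1 - z^2.\<close>
  also have "?g ^ Suc e + 2 * (fps_X * (?g ^ (e + 3) * (fps_const t - fps_X)))
      = ?g ^ (d + 1) * (1 - fps_X\<^sup>2)"
  proof -
    have "d + 1 = e + 3" by (simp add: d)
    moreover have "y + 2 * (x * (h * (c - x))) = h * (1 - x\<^sup>2)"
      if "h * (1 - 2 * c * x + x\<^sup>2) = y" for y h c x :: "real fps"
      unfolding that[symmetric] by (simp add: algebra_simps power2_eq_square)
    moreover have "?g ^ (e + 3) * quad_fps t = ?g ^ Suc e"
      using quad_rsqrt_squared[of t] by (simp add: power_add power3_eq_cube power2_eq_square algebra_simps)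
    ultimately show ?thesis unfolding quad_fps_alt by metis
  qed
  finally show ?thesis .
qed

lemma B_coeff_fps:
  "Abs_fps (B_coeff ((real d - 1) / 2)) = (1 + fps_X) ^ d * geometric_fps ^ (d + 1)"
proof -
  have e: "2 * ((real d - 1) / 2) + 1 = real d" "2 * ((real d - 1) / 2) + 2 = real (d + 1)"
    by (simp_all add: diff_divide_distrib)
  show ?thesis
    unfolding B_coeff_def e
    by (subst (1 2) fps_real_power_of_nat)
      (simp_all add: fps_divide_unit fps_inverse_power fps_nth_inverse del: power_Suc)
qed

text \<open>All terms of the convolution are nonnegative, and the term of index 0 is a positive
  binomial coefficient.\<close>

lemma B_coeff_pos: "B_coeff ((real d - 1) / 2) n > 0"
proof -
  let ?f = "(1 + fps_X :: real fps) ^ d" and ?h = "geometric_fps ^ Suc d"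
  have "B_coeff ((real d - 1) / 2) n = fps_nth (?f * ?h) n"
    using B_coeff_fps[of d] by (metis fps_nth_Abs_fps Suc_eq_plus1)
  also have "\<dots> \<ge> fps_nth ?f 0 * fps_nth ?h n"
    unfolding fps_mult_nth
    using sum_mono2[of "{0..n}" "{0}" "\<lambda>i. fps_nth ?f i * fps_nth ?h (n - i)"]
    by (auto simp: geometric_fps_power_nth one_plus_fps_X_power_nth_nonneg simp del: power_Suc)
  also have "fps_nth ?f 0 * fps_nth ?h n = real ((n + d) choose n)"
    by (simp add: geometric_fps_power_nth fps_nth_power_0 del: power_Suc)
  finally show ?thesis
    by (metis le_add1 less_le_trans of_nat_0_less_iff zero_less_binomial)
qed

lemma L_kernel_fps:
  assumes "d \<ge> 2" and "l = (real d - 1) / 2"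
  shows "L_kernel l n t = 1 / B_coeff l n *
    fps_nth ((1 + fps_X) ^ (d + 1) * quad_rsqrt t ^ (d + 1) * geometric_fps ^ d) n"
proof -
  let ?g = "quad_rsqrt t ^ (d + 1)"
  have "(\<Sum>k=0..n. B_coeff l (n - k) * ((real k + l) / l) * gegenbauer l k t) =
     fps_nth (Abs_fps (\<lambda>k. (real k + l) / l * gegenbauer l k t) * Abs_fps (B_coeff l)) n"
    unfolding fps_mult_nth by (intro sum.cong) (simp_all add: mult_ac)
  also have "Abs_fps (\<lambda>k. (real k + l) / l * gegenbauer l k t) * Abs_fps (B_coeff l)
     = (?g * (1 - fps_X\<^sup>2)) * ((1 + fps_X) ^ d * geometric_fps ^ (d + 1))"
    by (simp only: assms(2) gegenbauer_fps[OF assms(1)] B_coeff_fps)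
  \<comment> \<open>Of 1 - z^2 = (1 + z) (1 - z), the first factor joins
    \<open>(1 + fps_X) ^ d\<close> and the second cancels one geometric series.\<close>
  also have "\<dots> = (1 + fps_X) ^ (d + 1) * ?g * geometric_fps ^ d"
  proof -
    have "?g * (1 - fps_X\<^sup>2) * ((1 + fps_X) ^ d * geometric_fps ^ (d + 1))
      = (1 + fps_X) ^ (d + 1) * ?g * geometric_fps ^ d * (geometric_fps * (1 - fps_X))"
      by (simp add: algebra_simps power2_eq_square)
    then show ?thesis by (simp only: geometric_fps_mult mult_1_right)
  qed
  finally show ?thesis
    by (simp add: L_kernel_def)
qed

section \<open>Coefficient bound for the inverse square root, and the majorant of the second
  bound\<close>

lemma gbinomial_minus_half_nonneg: "(- 1) ^ n * ((- 1 / 2 :: real) gchoose n) \<ge> 0"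
proof -
  have "(- 1) ^ n * ((- 1 / 2 :: real) gchoose n) = pochhammer (1 / 2) n / fact n"
    by (simp add: gbinomial_pochhammer flip: power_mult_distrib)
  then show ?thesis by (simp add: pochhammer_nonneg)
qed

lemma nat_cases_2 [case_names zero one SucSuc]:
  obtains "n = 0" | "n = Suc 0" | k where "n = Suc (Suc k)"
  by (metis not0_implies_Suc)

lemma cos_three_term: "cos (x + y) - 2 * cos y * cos x + cos (x - y) = (0 :: real)"
  and sin_three_term: "sin (x + y) - 2 * cos y * sin x + sin (x - y) = (0 :: real)"
  by (simp_all add: cos_add cos_diff sin_add sin_diff)

text \<open>A is the product of w = 1 - z e^(i \<theta>) and its conjugate, so A powr (-1/2) is the
  squared modulus X^2 + Y^2 of w powr (-1/2) = X + i Y. Its coefficients are sums of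
  \<open>a i * a (n - i)\<close> times cosines, and the weights sum to 1. The argument is carried
  out with real series only.\<close>

lemma quad_rsqrt_majorized:
  fixes \<theta> :: real
  shows "fps_majorized (quad_rsqrt (cos \<theta>)) geometric_fps"
proof -
  define a where "a n = (- 1) ^ n * ((- 1 / 2 :: real) gchoose n)" for n
  have a_nonneg: "a n \<ge> 0" for n
    unfolding a_def by (rule gbinomial_minus_half_nonneg)
  \<comment> \<open>The \<open>a n\<close> are the coefficients of (1 - z) powr (-1/2), whose square
    is the geometric series.\<close>
  have conv: "(\<Sum>i=0..n. a i * a (n - i)) = 1" for n
  proof -
    have "(\<Sum>i=0..n. a i * a (n - i)) =
       (- 1) ^ n * (\<Sum>i=0..n. ((- 1 / 2 :: real) gchoose i) * ((- 1 / 2) gchoose (n - i)))"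
      unfolding sum_distrib_left a_def
      by (intro sum.cong refl) (auto simp: mult_ac simp flip: power_add)
    also have "(\<Sum>i=0..n. ((- 1 / 2 :: real) gchoose i) * ((- 1 / 2) gchoose (n - i)))
       = fps_nth (fps_binomial (- 1 / 2) * fps_binomial (- 1 / 2)) n"
      by (simp add: fps_mult_nth)
    also have "fps_binomial (- 1 / 2) * fps_binomial (- 1 / 2) = (fps_binomial (- 1) :: real fps)"
      by (simp flip: fps_binomial_add_mult)
    moreover have "(real n gchoose n) = 1"
      by (simp flip: binomial_gbinomial)
    ultimately show ?thesis
      by (simp add: gbinomial_minus flip: power_mult_distrib)
  qed
  define X Y :: "real fps" where
    "X = Abs_fps (\<lambda>n. a n * cos (real n * \<theta>))" and "Y = Abs_fps (\<lambda>n. a n * sin (real n * \<theta>))"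
  \<comment> \<open>Real and imaginary part of 1 / (1 - z e^(i \<theta>)), which is the square of X
    + i Y.\<close>
  define p q :: "real fps" where
    "p = Abs_fps (\<lambda>n. cos (real n * \<theta>))" and "q = Abs_fps (\<lambda>n. sin (real n * \<theta>))"
  have split: "real n * \<theta> = real i * \<theta> + real (n - i) * \<theta>" if "i \<le> n" for i n
    using that by (simp add: of_nat_diff algebra_simps)
  have cos_split: "a i * cos (real i * \<theta>) * (a (n - i) * cos (real (n - i) * \<theta>))
        - a i * sin (real i * \<theta>) * (a (n - i) * sin (real (n - i) * \<theta>))
        = a i * a (n - i) * cos (real n * \<theta>)"
    and sin_split: "a i * cos (real i * \<theta>) * (a (n - i) * sin (real (n - i) * \<theta>))
        + a i * sin (real i * \<theta>) * (a (n - i) * cos (real (n - i) * \<theta>))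
        = a i * a (n - i) * sin (real n * \<theta>)" if "i \<le> n" for i n
    unfolding split[OF that] cos_add sin_add by algebra+
  have "X\<^sup>2 - Y\<^sup>2 = p"
  proof (rule fps_ext)
    fix n
    have "fps_nth (X\<^sup>2 - Y\<^sup>2) n = (\<Sum>i=0..n. a i * a (n - i) * cos (real n * \<theta>))"
      unfolding X_def Y_def power2_eq_square
      unfolding fps_sub_nth fps_mult_nth fps_nth_Abs_fps sum_subtractf[symmetric]
      by (intro sum.cong refl cos_split) simp
    then show "fps_nth (X\<^sup>2 - Y\<^sup>2) n = fps_nth p n"
      by (simp add: conv p_def flip: sum_distrib_right)
  qed
  moreover have "X * Y + Y * X = q"
  proof (rule fps_ext)
    fix n
    have "fps_nth (X * Y + Y * X) n = (\<Sum>i=0..n. a i * a (n - i) * sin (real n * \<theta>))"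
      unfolding X_def Y_def fps_add_nth fps_mult_nth fps_nth_Abs_fps sum.distrib[symmetric]
      by (intro sum.cong refl sin_split) simp
    then show "fps_nth (X * Y + Y * X) n = fps_nth q n"
      by (simp add: conv q_def flip: sum_distrib_right)
  qed
  moreover have "(X\<^sup>2 + Y\<^sup>2)\<^sup>2 = (X\<^sup>2 - Y\<^sup>2)\<^sup>2 + (X * Y + Y * X)\<^sup>2"
    by (simp add: algebra_simps power2_eq_square)
  ultimately have sq: "(X\<^sup>2 + Y\<^sup>2)\<^sup>2 = p\<^sup>2 + q\<^sup>2"
    by simp
  let ?A = "quad_fps (cos \<theta>)"
  have rec: "p * ?A = 1 - fps_const (cos \<theta>) * fps_X" "q * ?A = fps_const (sin \<theta>) * fps_X"
  proof -
    have step: "cos (real (Suc (Suc n)) * \<theta>) - 2 * cos \<theta> * cos (real (Suc n) * \<theta>)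
        + cos (real n * \<theta>) = 0"
      "sin (real (Suc (Suc n)) * \<theta>) - 2 * cos \<theta> * sin (real (Suc n) * \<theta>) + sin (real n * \<theta>)
          = 0" for n
      using cos_three_term[of "real (Suc n) * \<theta>" \<theta>] sin_three_term[of "real (Suc n) * \<theta>" \<theta>]
      by (simp_all add: algebra_simps)
    show "p * ?A = 1 - fps_const (cos \<theta>) * fps_X"
    proof (rule fps_ext)
      fix n
      show "fps_nth (p * ?A) n = fps_nth (1 - fps_const (cos \<theta>) * fps_X) n"
      proof (cases n rule: nat_cases_2)
        case (SucSuc k)
        then show ?thesis
          using step(1)[of k] by (simp only: mult_quad_fps_nth p_def fps_nth_Abs_fps) simp
      qed (simp_all add: mult_quad_fps_nth quad_fps_nth p_def)
    qed
    show "q * ?A = fps_const (sin \<theta>) * fps_X"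
    proof (rule fps_ext)
      fix n
      show "fps_nth (q * ?A) n = fps_nth (fps_const (sin \<theta>) * fps_X) n"
      proof (cases n rule: nat_cases_2)
        case (SucSuc k)
        then show ?thesis
          using step(2)[of k] by (simp only: mult_quad_fps_nth q_def fps_nth_Abs_fps) simp
      qed (simp_all add: mult_quad_fps_nth quad_fps_nth q_def)
    qed
  qed
  \<comment> \<open>By \<open>rec\<close> the left side is (1 - z cos \<theta>)^2 + (z sin
    \<theta>)^2.\<close>
  have "(p\<^sup>2 + q\<^sup>2) * ?A\<^sup>2 = ?A"
  proof -
    have "(fps_const (cos \<theta>))\<^sup>2 + (fps_const (sin \<theta>))\<^sup>2 = 1"
      by (simp add: fps_const_power)
    then show ?thesis using rec unfolding quad_fps_alt by algebra
  qed
  then have "(p\<^sup>2 + q\<^sup>2) * ?A\<^sup>2 = (quad_rsqrt (cos \<theta>))\<^sup>2 * ?A\<^sup>2"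
    using quad_rsqrt_squared[of "cos \<theta>"] by (simp add: power2_eq_square[of ?A] flip: mult.assoc)
  moreover have "?A \<noteq> 0"
    using quad_fps_nth_0 by (metis fps_zero_nth zero_neq_one)
  ultimately have "(X\<^sup>2 + Y\<^sup>2)\<^sup>2 = (quad_rsqrt (cos \<theta>))\<^sup>2"
    by (simp add: sq)
  \<comment> \<open>Real power series form an integral domain, so equal squares agree up to sign;
    the constant term 1 decides the sign.\<close>
  then have "X\<^sup>2 + Y\<^sup>2 = quad_rsqrt (cos \<theta>) \<or> X\<^sup>2 + Y\<^sup>2 = - quad_rsqrt (cos \<theta>)"
    by (simp add: power2_eq_iff)
  moreover have "fps_nth (X\<^sup>2 + Y\<^sup>2) 0 = 1"
    by (simp add: X_def Y_def a_def power2_eq_square)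
  ultimately have eq: "quad_rsqrt (cos \<theta>) = X\<^sup>2 + Y\<^sup>2"
    using quad_rsqrt_nth_0[of "cos \<theta>"] by (metis fps_neg_nth one_neq_neg_one)
  have "\<bar>fps_nth (X\<^sup>2 + Y\<^sup>2) n\<bar> \<le> 1" for n
  proof -
    have "fps_nth (X\<^sup>2 + Y\<^sup>2) n = (\<Sum>i=0..n. a i * a (n - i) * cos (real i * \<theta> - real (n - i) * \<theta>))"
      unfolding X_def Y_def power2_eq_square fps_add_nth fps_mult_nth fps_nth_Abs_fps
        sum.distrib[symmetric] cos_diff
      by (intro sum.cong refl) algebra
    also have "\<bar>\<dots>\<bar> \<le> (\<Sum>i=0..n. \<bar>a i * a (n - i) * cos (real i * \<theta> - real (n - i) * \<theta>)\<bar>)"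
      by (rule sum_abs)
    also have "\<dots> \<le> (\<Sum>i=0..n. a i * a (n - i))"
      by (intro sum_mono) (simp add: abs_mult a_nonneg mult_left_le)
    finally show ?thesis by (simp add: conv)
  qed
  then show ?thesis
    by (simp add: fps_majorized_def eq geometric_fps_nth)
qed

text \<open>Expand (2 - (1 - z))^k binomially; each (1 - z)^i cancels i geometric series. Because of
  \<open>k \<le> m\<close> at least one of them always remains.\<close>

lemma one_plus_power_geometric_nth:
  assumes "k \<le> m"
  shows "fps_nth ((1 + fps_X) ^ k * geometric_fps ^ Suc m) n =
    (\<Sum>i=0..k. real (k choose i) * 2 ^ (k - i) * (- 1) ^ i * real ((n + (m - i)) choose n))"
proof -
  have "(1 + fps_X :: real fps) = - (1 - fps_X) + 2"
    by simp
  then have "(1 + fps_X :: real fps) ^ k = (\<Sum>i\<le>k. of_nat (k choose i) * (- (1 - fps_X)) ^ i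
      * 2 ^ (k - i))"
    by (metis binomial_ring)
  also have "\<dots> = (\<Sum>i=0..k. fps_const (real (k choose i) * 2 ^ (k - i) * (- 1) ^ i)
      * (1 - fps_X) ^ i)"
    unfolding atLeast0AtMost
  proof (intro sum.cong refl)
    fix i
    have "(- (1 - fps_X :: real fps)) ^ i = fps_const ((- 1) ^ i) * (1 - fps_X) ^ i"
      by (metis fps_const_neg fps_const_1_eq_1 fps_const_power power_minus)
    then show "of_nat (k choose i) * (- (1 - fps_X)) ^ i * 2 ^ (k - i)
      = fps_const (real (k choose i) * 2 ^ (k - i) * (- 1) ^ i) * (1 - fps_X :: real fps) ^ i"
      by (simp add: fps_of_nat numeral_fps_const fps_const_power mult_ac flip: fps_const_mult)
  qed
  finally have "(1 + fps_X) ^ k * geometric_fps ^ Suc m =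
     (\<Sum>i=0..k. fps_const (real (k choose i) * 2 ^ (k - i) * (- 1) ^ i) *
       ((1 - fps_X) ^ i * geometric_fps ^ Suc m))"
    by (simp add: sum_distrib_right mult.assoc)
  also have "\<dots> = (\<Sum>i=0..k. fps_const (real (k choose i) * 2 ^ (k - i) * (- 1) ^ i) *
       geometric_fps ^ Suc (m - i))"
  proof (intro sum.cong refl)
    fix i assume "i \<in> {0..k}"
    then have "Suc m = i + Suc (m - i)" using assms by simp
    then have "(1 - fps_X) ^ i * geometric_fps ^ Suc m =
      (geometric_fps * (1 - fps_X)) ^ i * geometric_fps ^ Suc (m - i)"
      by (simp only: power_add power_mult_distrib mult_ac)
    then show "fps_const (real (k choose i) * 2 ^ (k - i) * (- 1) ^ i) *
       ((1 - fps_X) ^ i * geometric_fps ^ Suc m) = fps_const (real (k choose i) * 2 ^ (k - i) * (- 1) ^ i) *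
       geometric_fps ^ Suc (m - i)"
      by (simp only: geometric_fps_mult power_one mult_1_left)
  qed
  finally show ?thesis
    by (simp only: fps_sum_nth fps_mult_left_const_nth geometric_fps_power_nth)
qed

section \<open>Trigonometric sums and estimates, truncated Poisson kernels\<close>

lemma sum_cos_roots_of_unity:
  assumes "0 < k" "k < N"
  shows "(\<Sum>j<N. cos (real k * (2 * pi * real j / real N))) = 0"
proof -
  define x where "x = pi * real k / real N"
  have "x > 0" "x < pi"
    using assms by (simp_all add: x_def field_simps)
  then have "sin x > 0" by (rule sin_gt_zero)
  have Nx: "real N * x = real k * pi"
    using assms by (simp add: x_def)
  \<comment> \<open>Multiplying by 2 sin x makes the sum telescope. The two ends cancel because N x
    is a multiple of pi.\<close>
  have "2 * sin x * (\<Sum>j<N. cos (real k * (2 * pi * real j / real N)))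
      = (\<Sum>j<N. sin ((2 * real (Suc j) - 1) * x) - sin ((2 * real j - 1) * x))"
    unfolding sum_distrib_left
  proof (intro sum.cong refl)
    fix j
    have "real k * (2 * pi * real j / real N) = 2 * real j * x"
      by (simp add: x_def)
    moreover have "(2 * real (Suc j) - 1) * x = 2 * real j * x + x"
      "(2 * real j - 1) * x = 2 * real j * x - x"
      by (simp_all add: algebra_simps)
    ultimately show "2 * sin x * cos (real k * (2 * pi * real j / real N))
        = sin ((2 * real (Suc j) - 1) * x) - sin ((2 * real j - 1) * x)"
      by (simp add: sin_add sin_diff)
  qed
  also have "\<dots> = sin ((2 * real N - 1) * x) - sin ((2 * real 0 - 1) * x)"
    by (rule sum_lessThan_telescope)
  also have "(2 * real N - 1) * x = real k * (2 * pi) + - x"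
    using Nx by (simp add: algebra_simps)
  also have "sin (real k * (2 * pi) + - x) = sin (- x)"
    using sin_npi[of "2 * k"] cos_npi[of "2 * k"] by (simp add: sin_diff mult_ac)
  finally show ?thesis
    using \<open>sin x > 0\<close> by simp
qed

text \<open>The difference vanishes at 0 and has derivative y sin y. The estimate bounds the factor
  \<open>x * cos x / sin x\<close> in \<open>kernel_fps_2_bounds\<close> by 1.\<close>

lemma sin_ge_mult_cos:
  fixes x :: real
  assumes "0 \<le> x" "x \<le> pi"
  shows "x * cos x \<le> sin x"
proof -
  have "(\<lambda>y. sin y - y * cos y) 0 \<le> (\<lambda>y. sin y - y * cos y) x"
    using assms(1)
  proof (rule DERIV_nonneg_imp_nondecreasing)
    fix y assume "0 \<le> y" "y \<le> x"
    moreover have "((\<lambda>y. sin y - y * cos y) has_real_derivative y * sin y) (at y)"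
      by (auto intro!: derivative_eq_intros)
    ultimately show "\<exists>z. ((\<lambda>y. sin y - y * cos y) has_real_derivative z) (at y) \<and> 0 \<le> z"
      using assms sin_ge_zero by (intro exI[of _ "y * sin y"]) auto
  qed
  then show ?thesis by simp
qed

lemma C'_const_bound: "- C'_const \<le> sinc t"
proof -
  obtain s where s: "sinc s = (INF t. sinc t)" "\<forall>t. sinc s \<le> sinc t"
    using sinc_attains_Inf by (elim exE conjE)
  show ?thesis
    unfolding C'_const_def minus_minus using s(2) unfolding s(1) by (rule spec)
qed

lemma C'_const_nonneg: "0 \<le> C'_const"
  using C'_const_bound[of pi] by simp

text \<open>\<open>T k\<close> stands for cos (k x), given only by the Chebyshev recurrence. The sum
  is the Poisson kernel of radius \<open>R\<close> cut off after order \<open>K\<close>. The ring is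
  general so that \<open>R\<close> can be a number or a power series.\<close>

lemma poisson_partial_sum:
  fixes T :: "nat \<Rightarrow> 'a::comm_ring_1"
  assumes "T 0 = 1" and "\<And>k. T (Suc (Suc k)) = 2 * T 1 * T (Suc k) - T k"
  shows "(1 - 2 * R * T 1 + R\<^sup>2) * (1 + 2 * (\<Sum>k=1..K. R ^ k * T k))
    = 1 - R\<^sup>2 + R ^ Suc K * (2 * R * T K - 2 * T (Suc K))"
proof (induction K)
  case 0
  then show ?case by (simp add: assms(1) algebra_simps power2_eq_square)
next
  case (Suc K)
  have "(1 - 2 * R * T 1 + R\<^sup>2) * (1 + 2 * (\<Sum>k=1..Suc K. R ^ k * T k))
    = (1 - 2 * R * T 1 + R\<^sup>2) * (1 + 2 * (\<Sum>k=1..K. R ^ k * T k))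
      + (1 - 2 * R * T 1 + R\<^sup>2) * (2 * (R ^ Suc K * T (Suc K)))"
    by (simp add: algebra_simps)
  also have "\<dots> = 1 - R\<^sup>2 + R ^ Suc (Suc K) * (2 * R * T (Suc K) - 2 * T (Suc (Suc K)))"
    unfolding Suc assms(2)[of K] by (simp add: algebra_simps power2_eq_square)
  finally show ?case .
qed

text \<open>With T 1 = cos (2 \<psi>), \<open>P\<close> is S^2 cos^2 \<psi> + W^2 sin^2 \<psi>. The
  radius R = (W - S) / (W + S) gives 4 P = (W + S)^2 (1 - 2 R T 1 + R^2) and (W + S)^2 (1 - R^2) = 4
  S W, so the truncated kernel approximates S W / P.\<close>

lemma poisson_partial_sum_quadratic:
  fixes T :: "nat \<Rightarrow> 'a::comm_ring_1"
  assumes "T 0 = 1" "\<And>k. T (Suc (Suc k)) = 2 * T 1 * T (Suc k) - T k"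
    and "W - S = R * (W + S)"
    and "4 * P = 2 * (S\<^sup>2 + W\<^sup>2) + 2 * (S\<^sup>2 - W\<^sup>2) * T 1"
  shows "4 * P * (1 + 2 * (\<Sum>k=1..K. R ^ k * T k))
    = 4 * S * W + R ^ Suc K * ((W + S)\<^sup>2 * (2 * R * T K - 2 * T (Suc K)))"
proof -
  have RV: "R\<^sup>2 * (W + S)\<^sup>2 = (W - S)\<^sup>2" "R * (W + S)\<^sup>2 = (W - S) * (W + S)"
    by (simp_all add: assms(3) power_mult_distrib power2_eq_square mult_ac)
  have "4 * P = (W + S)\<^sup>2 - 2 * T 1 * (R * (W + S)\<^sup>2) + R\<^sup>2 * (W + S)\<^sup>2"
    unfolding RV assms(4) by (simp add: algebra_simps power2_eq_square)
  then have "4 * P = (W + S)\<^sup>2 * (1 - 2 * R * T 1 + R\<^sup>2)"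
    by (simp add: algebra_simps)
  then have "4 * P * (1 + 2 * (\<Sum>k=1..K. R ^ k * T k))
     = (W + S)\<^sup>2 * ((1 - 2 * R * T 1 + R\<^sup>2) * (1 + 2 * (\<Sum>k=1..K. R ^ k * T k)))"
    by (subst mult.assoc[symmetric]) (erule arg_cong)
  also have "\<dots> = (W + S)\<^sup>2 * (1 - R\<^sup>2 + R ^ Suc K * (2 * R * T K - 2 * T (Suc K)))"
    by (subst poisson_partial_sum[of T, OF assms(1,2)]) (rule refl)
  also have "\<dots> = (W + S)\<^sup>2 - R\<^sup>2 * (W + S)\<^sup>2 + R ^ Suc K * ((W
      + S)\<^sup>2 * (2 * R * T K - 2 * T (Suc K)))"
    by (simp add: algebra_simps)
  also have "(W + S)\<^sup>2 - R\<^sup>2 * (W + S)\<^sup>2 = 4 * S * W"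
    unfolding RV by (simp add: algebra_simps power2_eq_square)
  finally show ?thesis .
qed

lemma cos_chebyshev_rec:
  "cos (real (Suc (Suc k)) * x) = 2 * cos (real 1 * x) * cos (real (Suc k) * x) - cos (real k * x)"
  using cos_three_term[of "real (Suc k) * x" x] by (simp add: algebra_simps)

text \<open>Summation over N equidistant nodes annihilates the cosines of orders 1 to N - 1. The map
  \<open>c\<close> is the identity or the embedding \<open>fps_const\<close>.\<close>

lemma sum_poisson_partial_sum:
  fixes c :: "real \<Rightarrow> 'a::comm_ring_1"
  assumes c_sum: "\<And>f :: nat \<Rightarrow> real. (\<Sum>j<N. c (f j)) = c (\<Sum>j<N. f j)" and "c 0 = 0" "N > 0"
  shows "(\<Sum>j<N. 1 + 2 * (\<Sum>k=1..N - 1. R ^ k * c (cos (real k * (2 * pi * real j / real N)))))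
      = of_nat N"
proof -
  have "(\<Sum>j<N. \<Sum>k=1..N - 1. R ^ k * c (cos (real k * (2 * pi * real j / real N))))
     = (\<Sum>k=1..N - 1. R ^ k * (\<Sum>j<N. c (cos (real k * (2 * pi * real j / real N)))))"
    unfolding sum_distrib_left by (rule sum.swap)
  also have "\<dots> = 0"
    unfolding c_sum using \<open>N > 0\<close> \<open>c 0 = 0\<close>
    by (intro sum.neutral ballI) (subst sum_cos_roots_of_unity, auto)
  finally show ?thesis
    by (simp add: sum.distrib flip: sum_distrib_left)
qed

section \<open>Closed forms for coefficients related to 1 / A\<close>

lemma cos_eq_sin_half: "cos \<theta> = 1 - 2 * (sin (\<theta> / 2))\<^sup>2" for \<theta> :: real
  using cos_double_sin[of "\<theta> / 2"] by simp

lemma cos_squared_half: "(cos (\<theta> / 2))\<^sup>2 = 1 - (sin (\<theta> / 2))\<^sup>2" for \<theta> :: real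
  by (simp add: cos_squared_eq)

lemma mult_quad_fps_imp: "f * quad_fps t = h \<Longrightarrow> h * (quad_rsqrt t)\<^sup>2 = f"
  using quad_rsqrt_squared[of t] by (metis mult.assoc mult.commute mult_1_right)

lemma quad_fps_split:
  "fps_const ((sin (\<theta> / 2))\<^sup>2) * (1 + fps_X)\<^sup>2 + fps_const ((cos (\<theta> / 2))\<^sup>2) * (1 - fps_X)\<^sup>2
    = quad_fps (cos \<theta>)"
proof -
  have *: "fps_const (cos \<theta>) = 1 - 2 * fps_const ((sin (\<theta> / 2))\<^sup>2)"
    "fps_const ((cos (\<theta> / 2))\<^sup>2) = 1 - fps_const ((sin (\<theta> / 2))\<^sup>2)"
    by (simp_all add: cos_eq_sin_half[of \<theta>] cos_squared_half numeral_fps_const flip: fps_const_1_eq_1)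
  show ?thesis
    unfolding quad_fps_alt * by (simp add: algebra_simps power2_eq_square)
qed

text \<open>Generating function of the Chebyshev polynomials of the second kind, multiplied by sin
  \<theta> to avoid a division by zero at \<theta> = pi.\<close>

lemma sin_quad_rsqrt_squared:
  "fps_const (sin \<theta>) * (quad_rsqrt (cos \<theta>))\<^sup>2 = Abs_fps (\<lambda>n. sin (real (Suc n) * \<theta>))"
proof (rule mult_quad_fps_imp, rule fps_ext)
  fix n
  show "fps_nth (Abs_fps (\<lambda>n. sin (real (Suc n) * \<theta>)) * quad_fps (cos \<theta>)) n
      = fps_nth (fps_const (sin \<theta>)) n"
  proof (cases n rule: nat_cases_2)
    case one
    then show ?thesis
      using sin_double[of \<theta>] by (simp add: mult_quad_fps_nth quad_fps_nth)
  next
    case (SucSuc k)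
    have "sin (real (Suc (Suc (Suc k))) * \<theta>) - 2 * cos \<theta> * sin (real (Suc (Suc k)) * \<theta>)
        + sin (real (Suc k) * \<theta>) = 0"
      using sin_three_term[of "real (Suc (Suc k)) * \<theta>" \<theta>] by (simp add: algebra_simps)
    then show ?thesis
      unfolding SucSuc mult_quad_fps_nth fps_nth_Abs_fps by simp
  qed (simp add: mult_quad_fps_nth quad_fps_nth)
qed

text \<open>(1 - z) / A generates the Chebyshev polynomials of the third kind, cos ((n + 1/2)
  \<theta>) / cos (\<theta> / 2).\<close>

lemma cos_half_quad_rsqrt_squared:
  "fps_const ((cos (\<theta> / 2))\<^sup>2) * (1 - fps_X) * (quad_rsqrt (cos \<theta>))\<^sup>2
    = Abs_fps (\<lambda>n. cos (\<theta> / 2) * cos ((real n + 1 / 2) * \<theta>))"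
proof (rule mult_quad_fps_imp, rule fps_ext)
  fix n
  show "fps_nth (Abs_fps (\<lambda>n. cos (\<theta> / 2) * cos ((real n + 1 / 2) * \<theta>)) * quad_fps (cos \<theta>)) n
    = fps_nth (fps_const ((cos (\<theta> / 2))\<^sup>2) * (1 - fps_X)) n"
  proof (cases n rule: nat_cases_2)
    case zero
    then show ?thesis
      by (simp add: mult_quad_fps_nth quad_fps_nth power2_eq_square)
  next
    case one
    \<comment> \<open>The recurrence continued to index -1, where cos (- \<theta> / 2) = cos
      (\<theta> / 2).\<close>
    have "cos ((real 1 + 1 / 2) * \<theta>) - 2 * cos \<theta> * cos ((real 0 + 1 / 2) * \<theta>) = - cos (\<theta> / 2)"
      using cos_three_term[of "\<theta> / 2" \<theta>] cos_minus[of "\<theta> / 2"] by (simp add: algebra_simps)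
    then have "cos (\<theta> / 2) * (cos ((real 1 + 1 / 2) * \<theta>) - 2 * cos \<theta> * cos ((real 0 + 1 / 2) * \<theta>))
        = fps_nth (fps_const ((cos (\<theta> / 2))\<^sup>2) * (1 - fps_X)) (Suc 0)"
      by (simp add: power2_eq_square)
    then show ?thesis
      unfolding one mult_quad_fps_nth fps_nth_Abs_fps by (simp only: right_diff_distrib mult_ac)
  next
    case (SucSuc k)
    have "cos ((real (Suc (Suc k)) + 1 / 2) * \<theta>)
        - 2 * cos \<theta> * cos ((real (Suc k) + 1 / 2) * \<theta>) + cos ((real k + 1 / 2) * \<theta>) = 0"
      using cos_three_term[of "(real (Suc k) + 1 / 2) * \<theta>" \<theta>] by (simp add: algebra_simps)
    then have "cos (\<theta> / 2) * (cos ((real (Suc (Suc k)) + 1 / 2) * \<theta>)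
        - 2 * cos \<theta> * cos ((real (Suc k) + 1 / 2) * \<theta>) + cos ((real k + 1 / 2) * \<theta>))
        = fps_nth (fps_const ((cos (\<theta> / 2))\<^sup>2) * (1 - fps_X)) (Suc (Suc k))"
      by simp
    then show ?thesis
      unfolding SucSuc mult_quad_fps_nth fps_nth_Abs_fps
      by (simp only: right_diff_distrib distrib_left mult_ac)
  qed
qed

lemma sin_half_squared_mult:
  "fps_const ((sin (\<theta> / 2))\<^sup>2) * ((1 + fps_X)\<^sup>2 * (quad_rsqrt (cos \<theta>))\<^sup>2 * f)
    = f - fps_const ((cos (\<theta> / 2))\<^sup>2) * (1 - fps_X)\<^sup>2 * (quad_rsqrt (cos \<theta>))\<^sup>2 * f"
proof -
  have "fps_const ((sin (\<theta> / 2))\<^sup>2) * (1 + fps_X)\<^sup>2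
      = quad_fps (cos \<theta>) - fps_const ((cos (\<theta> / 2))\<^sup>2) * (1 - fps_X)\<^sup>2"
    by (simp flip: quad_fps_split)
  then have "fps_const ((sin (\<theta> / 2))\<^sup>2) * ((1 + fps_X)\<^sup>2 * (quad_rsqrt (cos \<theta>))\<^sup>2 * f)
      = (quad_fps (cos \<theta>) - fps_const ((cos (\<theta> / 2))\<^sup>2) * (1 - fps_X)\<^sup>2) * ((quad_rsqrt (cos \<theta>))\<^sup>2 * f)"
    by (simp only: mult.assoc[symmetric])
  also have "\<dots> = ((quad_rsqrt (cos \<theta>))\<^sup>2 * quad_fps (cos \<theta>)) * f
      - fps_const ((cos (\<theta> / 2))\<^sup>2) * (1 - fps_X)\<^sup>2 * (quad_rsqrt (cos \<theta>))\<^sup>2 * f"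
    by (simp only: left_diff_distrib right_diff_distrib mult_ac)
  finally show ?thesis by (simp only: quad_rsqrt_squared mult_1_left)
qed

section \<open>The factors of the generating function and their bounds\<close>

definition kernel_fps_1 :: "real \<Rightarrow> real fps" where
  "kernel_fps_1 \<theta> = fps_const ((sin (\<theta> / 2))\<^sup>2) *
     ((1 + fps_X)\<^sup>2 * (quad_rsqrt (cos \<theta>))\<^sup>2 * geometric_fps)"

text \<open>The index is the number of geometric series attached to s (1 + z)^2 / A.\<close>

definition kernel_fps_2 :: "real \<Rightarrow> real fps" where
  "kernel_fps_2 \<theta> = fps_const ((sin (\<theta> / 2))\<^sup>2) *
     ((1 + fps_X)\<^sup>2 * (quad_rsqrt (cos \<theta>))\<^sup>2 * geometric_fps\<^sup>2)"

text \<open>The geometric series cancels one factor of (1 - z)^2 in 1 - c (1 - z)^2 / A, which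
  leaves a known closed form.\<close>

lemma kernel_fps_1_nth:
  "fps_nth (kernel_fps_1 \<theta>) n = 1 - cos (\<theta> / 2) * cos ((real n + 1 / 2) * \<theta>)"
proof -
  have "fps_const ((cos (\<theta> / 2))\<^sup>2) * (1 - fps_X)\<^sup>2 * (quad_rsqrt (cos \<theta>))\<^sup>2 * geometric_fps
     = fps_const ((cos (\<theta> / 2))\<^sup>2) * (1 - fps_X) * (quad_rsqrt (cos \<theta>))\<^sup>2 * (geometric_fps * (1 - fps_X))"
    by (simp only: power2_eq_square mult_ac)
  then show ?thesis
    unfolding kernel_fps_1_def sin_half_squared_mult geometric_fps_mult cos_half_quad_rsqrt_squared
    by (simp add: geometric_fps_nth cos_half_quad_rsqrt_squared)
qed

lemma abs_cos_mult_cos_le_one: "\<bar>cos x * cos y\<bar> \<le> (1 :: real)"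
  by (simp add: abs_mult mult_le_one)

lemma kernel_fps_1_bounds: "0 \<le> fps_nth (kernel_fps_1 \<theta>) n" "fps_nth (kernel_fps_1 \<theta>) n \<le> 2"
  using abs_cos_mult_cos_le_one[of "\<theta> / 2" "(real n + 1 / 2) * \<theta>"]
  unfolding kernel_fps_1_nth by linarith+

lemma kernel_fps_2_nth:
  "fps_nth (kernel_fps_2 \<theta>) n = real (Suc n) - (cos (\<theta> / 2))\<^sup>2 * fps_nth ((quad_rsqrt (cos \<theta>))\<^sup>2) n"
proof -
  have "fps_const ((cos (\<theta> / 2))\<^sup>2) * (1 - fps_X)\<^sup>2 * (quad_rsqrt (cos \<theta>))\<^sup>2 * geometric_fps\<^sup>2
     = fps_const ((cos (\<theta> / 2))\<^sup>2) * (quad_rsqrt (cos \<theta>))\<^sup>2 * (geometric_fps * (1 - fps_X))\<^sup>2"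
    by (simp only: power_mult_distrib mult_ac)
  then show ?thesis
    unfolding kernel_fps_2_def sin_half_squared_mult
    by (simp only: geometric_fps_mult power_one mult_1_right fps_sub_nth fps_mult_left_const_nth
        geometric_fps_squared_nth)
qed

text \<open>The lower bound follows from |u| \<le> n + 1. For the upper one put x = \<theta> / 2:
  then c u = (x cot x) (n + 1) \<open>sinc ((n + 1) \<theta>)\<close>, where x cot x lies between 0
  and 1 and \<open>sinc\<close> is at least \<open>- C'_const\<close>.\<close>

lemma kernel_fps_2_bounds:
  assumes "0 < \<theta>" "\<theta> \<le> pi"
  shows "0 \<le> fps_nth (kernel_fps_2 \<theta>) n" "fps_nth (kernel_fps_2 \<theta>) n \<le> C_const * real (Suc n)"
proof -
  define u where "u = fps_nth ((quad_rsqrt (cos \<theta>))\<^sup>2) n"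
  have "\<bar>u\<bar> \<le> real (Suc n)"
    using fps_majorized_power[OF quad_rsqrt_majorized, of \<theta> 2]
    unfolding fps_majorized_def geometric_fps_squared_nth u_def by blast
  then have "(cos (\<theta> / 2))\<^sup>2 * u \<le> (cos (\<theta> / 2))\<^sup>2 * real (Suc n)"
    by (intro mult_left_mono) auto
  also have "\<dots> \<le> 1 * real (Suc n)"
    by (intro mult_right_mono) (simp_all add: cos_squared_half)
  finally have "(cos (\<theta> / 2))\<^sup>2 * u \<le> real (Suc n)"
    by simp
  then show "0 \<le> fps_nth (kernel_fps_2 \<theta>) n"
    by (simp add: kernel_fps_2_nth u_def)
  have "(cos (\<theta> / 2))\<^sup>2 * u \<ge> - C'_const * real (Suc n)"
  \<comment> \<open>At pi the formula for u would divide by sin \<theta> = 0, but there cos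
    (\<theta> / 2) = 0.\<close>
  proof (cases "\<theta> = pi")
    case True
    then show ?thesis
      using C'_const_nonneg by simp
  next
    case False
    define x where "x = \<theta> / 2"
    have x: "0 < x" "x < pi / 2" "\<theta> = 2 * x"
      using assms False by (auto simp: x_def)
    have pos: "sin x > 0" "cos x > 0"
      using x by (auto intro: sin_gt_zero2 cos_gt_zero)
    define y where "y = sinc (real (Suc n) * \<theta>)"
    have y: "y \<ge> - C'_const"
      unfolding y_def by (rule C'_const_bound)
    have "sin \<theta> * u = sin (real (Suc n) * \<theta>)"
      using arg_cong[OF sin_quad_rsqrt_squared[of \<theta>], of "\<lambda>f. fps_nth f n"]
      by (simp add: u_def del: of_nat_Suc)
    also have "\<dots> = real (Suc n) * \<theta> * y"
      using assms by (simp add: y_def)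
    finally have "sin (2 * x) * u = real (Suc n) * (2 * x) * y"
      unfolding x(3) .
    then have "2 * sin x * (cos x * u) = real (Suc n) * (2 * x) * y"
      unfolding sin_double by (simp only: mult_ac)
    then have "cos x * (2 * sin x * (cos x * u)) = cos x * (real (Suc n) * (2 * x) * y)"
      by (rule arg_cong)
    then have "2 * ((cos x)\<^sup>2 * u * sin x) = 2 * (x * cos x * (real (Suc n) * y))"
      by (simp only: power2_eq_square mult_ac)
    then have "(cos x)\<^sup>2 * u * sin x = x * cos x * (real (Suc n) * y)"
      by (simp only: mult_cancel_left) simp
    then have eq: "(cos x)\<^sup>2 * u = (x * cos x / sin x) * (real (Suc n) * y)"
      using pos nonzero_eq_divide_eq[of "sin x" "(cos x)\<^sup>2 * u"] by simp
    have "x * cos x / sin x \<le> 1"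
      using sin_ge_mult_cos[of x] x pos by simp
    then have "(x * cos x / sin x) * (C'_const * real (Suc n)) \<le> C'_const * real (Suc n)"
      using C'_const_nonneg by (intro mult_left_le_one_le) (use x pos in auto)
    moreover have "(x * cos x / sin x) * (real (Suc n) * y)
       \<ge> (x * cos x / sin x) * (real (Suc n) * - C'_const)"
      using x pos y by (intro mult_left_mono) auto
    ultimately show ?thesis
      using eq unfolding x_def by (simp add: mult_ac)
  qed
  then show "fps_nth (kernel_fps_2 \<theta>) n \<le> C_const * real (Suc n)"
    by (simp add: kernel_fps_2_nth u_def C_const_def algebra_simps)
qed

section \<open>The remaining square root as an average over angles\<close>

lemma fps_power_mult_nth_eq_0:
  fixes R :: "'a::comm_ring_1 fps"
  assumes "fps_nth R 0 = 0" "n < N"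
  shows "fps_nth (R ^ N * f) n = 0"
  using startsby_zero_power_prefix[OF assms(1), of N] assms(2)
  by (auto simp: fps_mult_nth intro!: sum.neutral)

lemma sum_fps_const: "(\<Sum>j\<in>A. fps_const (f j)) = fps_const (\<Sum>j\<in>A. f j)"
  by (induction A rule: infinite_finite_induct) simp_all

text \<open>The truncated Poisson kernel with W = 1 + z and S^2 = A, summed over the nodes. It
  expresses (1 + z) / sqrt A through the series (1 + z)^2 / A at other parameters.\<close>

lemma quad_rsqrt_average:
  assumes "n < N"
  defines "c \<equiv> \<lambda>j. cos (2 * pi * real j / real N)"
  shows "real N * fps_nth ((1 + fps_X) * quad_rsqrt t * f) n
    = (\<Sum>j<N. fps_nth ((1 + fps_X)\<^sup>2 * (quad_rsqrt ((t * (1 + c j) - (1 - c j)) / 2))\<^sup>2 * f) n)"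
proof -
  define W :: "real fps" where "W = 1 + fps_X"
  define g where "g = quad_rsqrt t"
  define S where "S = inverse g"
  \<comment> \<open>\<open>W\<close> and \<open>S\<close> have constant term 1, so
    \<open>W + S\<close> is invertible and \<open>R\<close> has constant term 0.\<close>
  define R where "R = (W - S) * inverse (W + S)"
  define tt where "tt j = (t * (1 + c j) - (1 - c j)) / 2" for j
  define q where "q j = (quad_rsqrt (tt j))\<^sup>2" for j
  define T where "T j k = fps_const (cos (real k * (2 * pi * real j / real N)))" for j k
  define E where "E j = (W + S)\<^sup>2 * (2 * R * T j (N - 1) - 2 * T j N)" for j
  have gS: "g * S = 1"
    by (simp add: S_def g_def quad_rsqrt_nth_0 inverse_mult_eq_1')
  have S2: "S\<^sup>2 = quad_fps t"
  proof -
    have "S\<^sup>2 = S\<^sup>2 * (g\<^sup>2 * quad_fps t)"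
      by (simp add: g_def quad_rsqrt_squared)
    also have "\<dots> = (g * S)\<^sup>2 * quad_fps t"
      by (simp only: power_mult_distrib mult_ac)
    finally show ?thesis by (simp add: gS)
  qed
  have S0: "fps_nth S 0 = 1"
    by (simp add: S_def g_def quad_rsqrt_nth_0)
  have R0: "fps_nth R 0 = 0"
    by (simp add: R_def W_def S0)
  have R: "W - S = R * (W + S)"
    using S0 by (simp add: R_def W_def mult.assoc inverse_mult_eq_1)
  have N: "N > 0" "Suc (N - 1) = N" using assms(1) by auto
  have one: "4 * (W * g * f) * (1 + 2 * (\<Sum>k=1..N - 1. R ^ k * T j k))
     = 4 * (W\<^sup>2 * q j * f) + R ^ N * (W * g * f * q j * E j)" for j
  proof -
    have T1: "T j 1 = fps_const (c j)"
      by (simp add: T_def c_def)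
    \<comment> \<open>W^2 is \<open>quad_fps (- 1)\<close>, so the mean of S^2 and W^2 with weights
      (1 + c j) / 2 and (1 - c j) / 2 is the quadratic at the same mean \<open>tt j\<close> of t and
      -1.\<close>
    have P: "4 * quad_fps (tt j) = 2 * (S\<^sup>2 + W\<^sup>2) + 2 * (S\<^sup>2 - W\<^sup>2) * T j 1"
      unfolding S2 T1
    proof (rule fps_ext)
      fix n
      show "fps_nth (4 * quad_fps (tt j)) n =
        fps_nth (2 * (quad_fps t + W\<^sup>2) + 2 * (quad_fps t - W\<^sup>2) * fps_const (c j)) n"
        by (cases n rule: nat_cases_2)
         (simp_all add: quad_fps_def W_def power2_eq_square numeral_fps_const tt_def field_simps)
    qed
    have "4 * quad_fps (tt j) * (1 + 2 * (\<Sum>k=1..N - 1. R ^ k * T j k)) = 4 * S * W + R ^ N * E j"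
    proof -
      have "T j (Suc (Suc k)) = 2 * T j 1 * T j (Suc k) - T j k" for k
        unfolding T_def by (subst cos_chebyshev_rec) (simp add: numeral_fps_const)
      moreover have "T j 0 = 1" by (simp add: T_def)
      ultimately show ?thesis
        unfolding E_def using poisson_partial_sum_quadratic[where T = "T j", OF _ _ R P, of "N - 1"] N(2) by simp
    qed
    then have "(W * g * f * q j) * (4 * quad_fps (tt j) * (1 + 2 * (\<Sum>k=1..N - 1. R ^ k * T j k)))
      = (W * g * f * q j) * (4 * S * W + R ^ N * E j)"
      by simp
    moreover have "(W * g * f * q j) * (4 * quad_fps (tt j) * Z)
      = (q j * quad_fps (tt j)) * (4 * (W * g * f) * Z)" for Z
      by (simp only: mult_ac)
    moreover have "(W * g * f * q j) * (4 * S * W + R ^ N * E j)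
      = (g * S) * (4 * (W\<^sup>2 * q j * f)) + R ^ N * (W * g * f * q j * E j)"
      by (simp only: distrib_left power2_eq_square mult_ac)
    moreover have "q j * quad_fps (tt j) = 1"
      by (simp add: q_def quad_rsqrt_squared)
    ultimately show ?thesis by (simp only: gS mult_1_left)
  qed
  have "(\<Sum>j<N. 1 + 2 * (\<Sum>k=1..N - 1. R ^ k * T j k)) = of_nat N"
    unfolding T_def using N(1) by (intro sum_poisson_partial_sum) (simp_all add: sum_fps_const)
  then have "4 * (W * g * f) * of_nat N = (\<Sum>j<N. 4 * (W\<^sup>2 * q j * f)
      + R ^ N * (W * g * f * q j * E j))"
    by (simp only: flip: one sum_distrib_left)
  also have "\<dots> = 4 * (\<Sum>j<N. W\<^sup>2 * q j * f) + R ^ N * (\<Sum>j<N. W * g * f * q j * E j)"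
    by (simp only: sum.distrib sum_distrib_left)
  \<comment> \<open>The remainder is a multiple of \<open>R ^ N\<close> and does not reach the order
    n < N.\<close>
  finally have "fps_nth (4 * (W * g * f) * of_nat N) n = fps_nth (4 * (\<Sum>j<N. W\<^sup>2 * q j * f)) n"
    using fps_power_mult_nth_eq_0[OF R0 assms(1)] by simp
  moreover have "4 * (W * g * f) * of_nat N = fps_const (4 * real N) * (W * g * f)"
    by (simp only: fps_const_mult[symmetric] fps_of_nat numeral_fps_const mult_ac)
  ultimately have "fps_nth (fps_const (4 * real N) * (W * g * f)) n
      = fps_nth (4 * (\<Sum>j<N. W\<^sup>2 * q j * f)) n"
    by (simp only:)
  then have "4 * (real N * fps_nth (W * g * f) n) = 4 * (\<Sum>j<N. fps_nth (W\<^sup>2 * q j * f) n)"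
    unfolding numeral_fps_const fps_mult_left_const_nth fps_sum_nth mult.assoc .
  then show ?thesis
    by (simp add: W_def g_def q_def tt_def)
qed

text \<open>The same quadrature for numbers, with W = 1, S = r and \<psi> = pi j / N. Here the
  remainder does not vanish, but it decays geometrically in N.\<close>

lemma sum_reciprocal_quadrature_bound:
  assumes "0 < r" "r \<le> 1" "N > 0"
  defines "\<sigma> \<equiv> \<lambda>j. (r\<^sup>2 * (1 + cos (2 * pi * real j / real N))
      + (1 - cos (2 * pi * real j / real N))) / 2"
  shows "(\<Sum>j<N. r / \<sigma> j) \<le> real N * (1 + 4 * ((1 - r) / (1 + r)) ^ N / r\<^sup>2)"
    and "\<And>j. 0 < \<sigma> j"
proof -
  define \<rho> where "\<rho> = (1 - r) / (1 + r)"
  have \<rho>: "0 \<le> \<rho>" "\<rho> \<le> 1" "1 - r = \<rho> * (1 + r)"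
    using assms by (simp_all add: \<rho>_def)
  define T where "T j k = cos (real k * (2 * pi * real j / real N))" for j k
  have N: "Suc (N - 1) = N" using \<open>N > 0\<close> by simp
  \<comment> \<open>\<open>\<sigma> j\<close> is a convex combination of r^2 and 1.\<close>
  have \<sigma>_ge: "r\<^sup>2 \<le> \<sigma> j" for j
  proof -
    have "\<sigma> j - r\<^sup>2 = (1 - r\<^sup>2) * (1 - cos (2 * pi * real j / real N)) / 2"
      by (simp add: \<sigma>_def field_simps)
    moreover have "r\<^sup>2 \<le> 1"
      using assms by (simp add: power_le_one)
    ultimately show ?thesis
      using mult_nonneg_nonneg[of "1 - r\<^sup>2" "1 - cos (2 * pi * real j / real N)"]
      by (simp del: mult_nonneg_nonneg)
  qed
  have "0 < r\<^sup>2" using \<open>0 < r\<close> by simp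
  then show \<sigma>_pos: "0 < \<sigma> j" for j
    using \<sigma>_ge less_le_trans by blast
  have "r / \<sigma> j \<le> 1 + 2 * (\<Sum>k=1..N - 1. \<rho> ^ k * T j k) + 4 * \<rho> ^ N / r\<^sup>2" for j
  proof -
    define Z where "Z = 1 + 2 * (\<Sum>k=1..N - 1. \<rho> ^ k * T j k)"
    have "T j (Suc (Suc k)) = 2 * T j 1 * T j (Suc k) - T j k" for k
      unfolding T_def by (rule cos_chebyshev_rec)
    moreover have "T j 0 = 1" by (simp add: T_def)
    moreover have "4 * \<sigma> j = 2 * (r\<^sup>2 + 1\<^sup>2) + 2 * (r\<^sup>2 - 1\<^sup>2) * T j 1"
      by (simp add: \<sigma>_def T_def field_simps)
    ultimately have eq: "4 * \<sigma> j * Z = 4 * r + \<rho> ^ N * ((1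
        + r)\<^sup>2 * (2 * \<rho> * T j (N - 1) - 2 * T j N))"
      using poisson_partial_sum_quadratic[where T = "T j", OF _ _ \<rho>(3), of "\<sigma> j" "N - 1"] N
      unfolding Z_def by simp
    have T_le: "\<bar>T j k\<bar> \<le> 1" for k by (simp add: T_def)
    have "\<bar>\<rho> * T j (N - 1)\<bar> \<le> 1 * 1"
      unfolding abs_mult using \<rho> T_le by (intro mult_mono) auto
    then have "\<bar>2 * \<rho> * T j (N - 1) - 2 * T j N\<bar> \<le> 4"
      using T_le[of N] by linarith
    moreover have "(1 + r)\<^sup>2 \<le> 2\<^sup>2"
      using assms by (intro power_mono) auto
    ultimately have "(1 + r)\<^sup>2 * \<bar>2 * \<rho> * T j (N - 1) - 2 * T j N\<bar> \<le> 4 * 4"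
      by (intro mult_mono) auto
    then have "\<bar>(1 + r)\<^sup>2 * (2 * \<rho> * T j (N - 1) - 2 * T j N)\<bar> \<le> 16"
      by (simp add: abs_mult)
    then have "\<rho> ^ N * ((1 + r)\<^sup>2 * (2 * \<rho> * T j (N - 1) - 2 * T j N)) \<ge> \<rho> ^ N * (- 16)"
      using \<rho> by (intro mult_left_mono) auto
    then have "r \<le> \<sigma> j * Z + 4 * \<rho> ^ N"
      using eq by linarith
    then have "r / \<sigma> j \<le> Z + 4 * \<rho> ^ N / \<sigma> j"
      using \<sigma>_pos[of j] by (simp add: field_simps)
    moreover have "4 * \<rho> ^ N / \<sigma> j \<le> 4 * \<rho> ^ N / r\<^sup>2"
      using \<sigma>_ge \<open>0 < r\<^sup>2\<close> \<rho> by (intro divide_left_mono) (auto intro: mult_pos_pos \<sigma>_pos)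
    ultimately show ?thesis by (simp add: Z_def)
  qed
  then have "(\<Sum>j<N. r / \<sigma> j) \<le> (\<Sum>j<N. (1 + 2 * (\<Sum>k=1..N - 1. \<rho> ^ k * T j k)) + 4 * \<rho> ^ N / r\<^sup>2)"
    by (intro sum_mono) auto
  also have "\<dots> = (\<Sum>j<N. 1 + 2 * (\<Sum>k=1..N - 1. \<rho> ^ k * T j k)) + real N * (4 * \<rho> ^ N / r\<^sup>2)"
    by (subst sum.distrib) simp
  also have "(\<Sum>j<N. 1 + 2 * (\<Sum>k=1..N - 1. \<rho> ^ k * T j k)) = real N"
    unfolding T_def using sum_poisson_partial_sum[of "\<lambda>x. x" N \<rho>] \<open>N > 0\<close> by simp
  finally show "(\<Sum>j<N. r / \<sigma> j) \<le> real N * (1 + 4 * ((1 - r) / (1 + r)) ^ N / r\<^sup>2)"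
    by (simp add: \<rho>_def distrib_left)
qed

text \<open>The square root of s (1 + z)^2 / A, left over for even d, with one geometric
  series.\<close>

definition kernel_fps_half :: "real \<Rightarrow> real fps" where
  "kernel_fps_half \<theta> = fps_const (sin (\<theta> / 2)) * ((1 + fps_X) * quad_rsqrt (cos \<theta>) * geometric_fps)"

text \<open>The coefficient is r times a mean over N nodes. At node j the bound 2 of
  \<open>kernel_fps_1_bounds\<close> gives at most \<open>2 / \<sigma> j\<close>, and the bound on
  the mean of \<open>r / \<sigma> j\<close> tends to 1 as N grows with n fixed.\<close>

lemma kernel_fps_half_le:
  assumes "0 < \<theta>" "\<theta> \<le> pi"
  shows "fps_nth (kernel_fps_half \<theta>) n \<le> 2"
proof -
  define r where "r = sin (\<theta> / 2)"
  have r: "0 < r" "r \<le> 1"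
    using assms by (auto simp: r_def intro: sin_gt_zero)
  define \<rho> where "\<rho> = (1 - r) / (1 + r)"
  have \<rho>: "0 \<le> \<rho>" "\<rho> < 1"
    using r by (simp_all add: \<rho>_def)
  have "fps_nth (kernel_fps_half \<theta>) n \<le> 2 * (1 + 4 * \<rho> ^ N / r\<^sup>2)" if "N > n" for N
  proof -
    define c where "c j = cos (2 * pi * real j / real N)" for j :: nat
    define \<sigma> where "\<sigma> j = (r\<^sup>2 * (1 + c j) + (1 - c j)) / 2" for j
    define tt where "tt j = (cos \<theta> * (1 + c j) - (1 - c j)) / 2" for j
    have "N > 0" using that by simp
    note \<sigma>_sum = sum_reciprocal_quadrature_bound(1)[OF r \<open>N > 0\<close>, folded c_def \<sigma>_def \<rho>_def]
    note \<sigma>_pos = sum_reciprocal_quadrature_bound(2)[OF r \<open>N > 0\<close>, folded c_def \<sigma>_def]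
    have term_le: "fps_nth ((1 + fps_X)\<^sup>2 * (quad_rsqrt (tt j))\<^sup>2 * geometric_fps) n
        \<le> 2 / \<sigma> j" for j
    proof -
      have c: "\<bar>c j\<bar> \<le> 1" by (simp add: c_def)
      \<comment> \<open>Thus \<open>\<sigma> j\<close> is the squared sine of half the angle whose
        cosine is \<open>tt j\<close>.\<close>
      have tt: "tt j = 1 - 2 * \<sigma> j"
        by (simp add: tt_def \<sigma>_def r_def cos_eq_sin_half[of \<theta>] field_simps)
      have "tt j + 1 = (cos \<theta> + 1) * (1 + c j) / 2"
        by (simp add: tt_def field_simps)
      also have "\<dots> \<ge> 0"
        using c cos_ge_minus_one[of \<theta>]
        by (intro divide_nonneg_pos mult_nonneg_nonneg) (linarith | simp)+
      finally have "- 1 \<le> tt j" "tt j \<le> 1"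
        using \<sigma>_pos[of j] by (auto simp: tt)
      then have arccos: "cos (arccos (tt j)) = tt j"
        by (rule cos_arccos)
      have "(sin (arccos (tt j) / 2))\<^sup>2 = \<sigma> j"
        using cos_eq_sin_half[of "arccos (tt j)"] arccos tt by simp
      then have "\<sigma> j * fps_nth ((1 + fps_X)\<^sup>2 * (quad_rsqrt (tt j))\<^sup>2 * geometric_fps) n \<le> 2"
        using kernel_fps_1_bounds(2)[of "arccos (tt j)" n] unfolding kernel_fps_1_def arccos
        by (simp only: fps_mult_left_const_nth)
      then show ?thesis
        using \<sigma>_pos[of j] by (simp add: field_simps)
    qed
    have "real N * fps_nth (kernel_fps_half \<theta>) n
        = r * (real N * fps_nth ((1 + fps_X) * quad_rsqrt (cos \<theta>) * geometric_fps) n)"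
      unfolding kernel_fps_half_def r_def fps_mult_left_const_nth by (simp only: mult_ac)
    also have "\<dots> = r * (\<Sum>j<N. fps_nth ((1 + fps_X)\<^sup>2 * (quad_rsqrt (tt j))\<^sup>2 * geometric_fps) n)"
      using quad_rsqrt_average[OF that] by (simp only: tt_def c_def)
    also have "\<dots> \<le> r * (\<Sum>j<N. 2 / \<sigma> j)"
      using r term_le by (intro mult_left_mono sum_mono) auto
    also have "\<dots> = 2 * (\<Sum>j<N. r / \<sigma> j)"
      by (simp add: sum_distrib_left mult_ac)
    also have "\<dots> \<le> 2 * (real N * (1 + 4 * \<rho> ^ N / r\<^sup>2))"
      using \<sigma>_sum by simp
    finally show ?thesis
      using \<open>N > 0\<close> by (simp add: mult.left_commute[of 2])
  qed
  then have "\<forall>\<^sub>F N in sequentially. fps_nth (kernel_fps_half \<theta>) n \<le> 2 * (1 + 4 * \<rho> ^ N / r\<^sup>2)"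
    using eventually_gt_at_top by (rule eventually_mono[rotated])
  moreover have "(\<lambda>N. 2 * (1 + 4 * \<rho> ^ N / r\<^sup>2)) \<longlonglongrightarrow> 2 * (1 + 4 * 0 / r\<^sup>2)"
    using \<rho> r by (intro tendsto_intros LIMSEQ_realpow_zero) auto
  ultimately show ?thesis
    using tendsto_lowerbound[of _ "2 * (1 + 4 * 0 / r\<^sup>2)" sequentially] by simp
qed

section \<open>Products of the factors and the two kernel bounds\<close>

lemma kernel_fps_2_power_mult_le:
  assumes "0 < \<theta>" "\<theta> \<le> pi" and "\<And>i. fps_nth f i \<le> fps_nth (fps_const b * geometric_fps ^ k) i" "0
      \<le> b"
  shows "fps_nth (kernel_fps_2 \<theta> ^ m * f) n
      \<le> b * C_const ^ m * fps_nth (geometric_fps ^ (k + 2 * m)) n"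
proof -
  let ?G = "kernel_fps_2 \<theta>" and ?J = "geometric_fps"
  have "fps_majorized ?G (fps_const C_const * ?J\<^sup>2)"
    using kernel_fps_2_bounds[OF assms(1,2)]
    unfolding fps_majorized_def by (simp add: geometric_fps_squared_nth)
  moreover have "fps_majorized (fps_const b * ?J ^ k) (fps_const b * ?J ^ k)"
    using fps_power_nonneg[of ?J] \<open>0 \<le> b\<close> by (intro fps_majorized_refl) (simp add: geometric_fps_nth)
  ultimately have "fps_majorized (?G ^ m * (fps_const b * ?J ^ k))
       ((fps_const C_const * ?J\<^sup>2) ^ m * (fps_const b * ?J ^ k))"
    by (metis fps_majorized_mult fps_majorized_power)
  then have "fps_nth (?G ^ m * (fps_const b * ?J ^ k)) n
     \<le> fps_nth ((fps_const C_const * ?J\<^sup>2) ^ m * (fps_const b * ?J ^ k)) n"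
    by (rule fps_majorized_nthD)
  also have "(fps_const C_const * ?J\<^sup>2) ^ m * (fps_const b * ?J ^ k)
     = fps_const (b * C_const ^ m) * ?J ^ (k + 2 * m)"
    by (simp only: power_mult_distrib fps_const_power power_add power_mult power2_eq_square
        fps_const_mult[symmetric] mult_ac)
  finally have "fps_nth (?G ^ m * (fps_const b * ?J ^ k)) n
      \<le> b * C_const ^ m * fps_nth (?J ^ (k + 2 * m)) n"
    by simp
  \<comment> \<open>\<open>f\<close> is bounded only from above, which is enough because
    \<open>?G ^ m\<close> has nonnegative coefficients.\<close>
  moreover have "fps_nth (?G ^ m * f) n \<le> fps_nth (?G ^ m * (fps_const b * ?J ^ k)) n"
    using kernel_fps_2_bounds(1)[OF assms(1,2)] assms(3)
    by (intro fps_mult_left_mono fps_power_nonneg)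
  ultimately show ?thesis by linarith
qed

theorem theorem2:
  fixes d n :: nat and l :: real
  assumes "d \<ge> 2"
    and "l = (real d - 1) / 2"
  shows "(\<forall>\<theta>. 0 < \<theta> \<and> \<theta> \<le> pi \<longrightarrow>
           L_kernel l n (cos \<theta>) \<le>
             D_const l * (C_const ^ nat \<lfloor>l\<rfloor> / (B_coeff l n * sin (\<theta> / 2) ^ (d + 1)))
               * real ((n + (d - 1)) choose n)) \<and>
         (\<forall>\<theta>. 0 \<le> \<theta> \<and> \<theta> \<le> pi \<longrightarrow>
           L_kernel l n (cos \<theta>) \<le>
             1 / B_coeff l n *
               (\<Sum>i=0..d+1.
                  real ((d + 1) choose i) * 2 ^ (d + 1 - i) * (- 1) ^ i
                    * real ((n + (2 * d - i)) choose n)))"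
proof -
  have B: "B_coeff l n > 0"
    unfolding assms(2) by (rule B_coeff_pos)
  define F where "F \<theta> = (1 + fps_X) ^ (d + 1) * quad_rsqrt (cos \<theta>) ^ (d
      + 1) * geometric_fps ^ d" for \<theta>
  have L: "L_kernel l n (cos \<theta>) = 1 / B_coeff l n * fps_nth (F \<theta>) n" for \<theta>
    unfolding F_def by (rule L_kernel_fps[OF assms])
  \<comment> \<open>The first bound with its positive denominators cleared.\<close>
  have sharp: "sin (\<theta> / 2) ^ (d + 1) * fps_nth (F \<theta>) n
      \<le> D_const l * C_const ^ nat \<lfloor>l\<rfloor> * real ((n + (d - 1)) choose n)"
    if \<theta>: "0 < \<theta>" "\<theta> \<le> pi" for \<theta>
  proof (cases "odd d")
    case True
    then obtain m where d: "d = 2 * m + 1" by (elim oddE)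
    then have l: "l = real m" by (simp add: assms(2))
    \<comment> \<open>The exponent d + 1 = 2 m + 2 gives m + 1 squares; the 2 m + 1 geometric series
      are shared out as 2 m + 1.\<close>
    have "fps_const (sin (\<theta> / 2) ^ (d + 1)) * F \<theta> = kernel_fps_2 \<theta> ^ m * kernel_fps_1 \<theta>"
      unfolding F_def kernel_fps_1_def kernel_fps_2_def d
      by (simp only: fps_const_power[symmetric] fps_const_mult[symmetric] power_add power_mult power2_eq_square
          power_mult_distrib power_one_right mult_ac)
    then have "sin (\<theta> / 2) ^ (d + 1) * fps_nth (F \<theta>) n
        = fps_nth (kernel_fps_2 \<theta> ^ m * kernel_fps_1 \<theta>) n"
      by (metis fps_mult_left_const_nth)
    also have "\<dots> \<le> 2 * C_const ^ m * fps_nth (geometric_fps ^ (1 + 2 * m)) n"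
      using kernel_fps_1_bounds(2) by (intro kernel_fps_2_power_mult_le \<theta>) (simp_all add: geometric_fps_nth)
    finally show ?thesis
      using geometric_fps_power_nth[of "2 * m" n] by (simp add: D_const_def l d)
  next
    case False
    then have "even d" by simp
    then obtain e where e: "d = 2 * e" by (elim evenE)
    with assms(1) obtain m where "e = Suc m" by (cases e) auto
    with e have d: "d = 2 * m + 2" by simp
    have l: "l = real m + 1 / 2" by (simp add: assms(2) d field_simps)
    then have floor: "\<lfloor>l\<rfloor> = int m" by (simp add: floor_eq_iff)
    have "l \<notin> \<nat>"
    proof
      assume "l \<in> \<nat>"
      then obtain k where "l = real k" by (elim Nats_cases)
      then have "real (2 * k) = real (2 * m + 1)" using l by simp
      then have "2 * k = 2 * m + 1" by (simp only: of_nat_eq_iff)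
      then show False by presburger
    qed
    then have D: "D_const l = 4" by (simp add: D_const_def)
    \<comment> \<open>The odd exponent 2 m + 3 leaves one square root; the 2 m + 2 geometric series
      are shared out as 2 m + 1 + 1.\<close>
    have "fps_const (sin (\<theta> / 2) ^ (d + 1)) * F \<theta>
        = kernel_fps_2 \<theta> ^ m * (kernel_fps_1 \<theta> * kernel_fps_half \<theta>)"
      unfolding F_def kernel_fps_1_def kernel_fps_2_def kernel_fps_half_def d
      by (simp only: fps_const_power[symmetric] fps_const_mult[symmetric] power_add power_mult power2_eq_square
          power_mult_distrib power_one_right mult_ac)
    then have "sin (\<theta> / 2) ^ (d + 1) * fps_nth (F \<theta>) n
       = fps_nth (kernel_fps_2 \<theta> ^ m * (kernel_fps_1 \<theta> * kernel_fps_half \<theta>)) n"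
      by (metis fps_mult_left_const_nth)
    also have "\<dots> \<le> 4 * C_const ^ m * fps_nth (geometric_fps ^ (2 + 2 * m)) n"
    proof (intro kernel_fps_2_power_mult_le \<theta>)
      fix i
      \<comment> \<open>\<open>kernel_fps_half\<close> is bounded only from above, so it is replaced
        first, against the nonnegative \<open>kernel_fps_1\<close>.\<close>
      have "fps_nth (kernel_fps_1 \<theta> * kernel_fps_half \<theta>) i
          \<le> fps_nth (kernel_fps_1 \<theta> * (fps_const 2 * geometric_fps)) i"
        using kernel_fps_1_bounds(1) kernel_fps_half_le[OF \<theta>]
        by (intro fps_mult_left_mono) (simp_all add: geometric_fps_nth)
      also have "\<dots> = fps_nth ((fps_const 2 * geometric_fps) * kernel_fps_1 \<theta>) i"
        by (simp only: mult_ac)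
      also have "\<dots> \<le> fps_nth ((fps_const 2 * geometric_fps) * (fps_const 2 * geometric_fps)) i"
        using kernel_fps_1_bounds(2) by (intro fps_mult_left_mono) (simp_all add: geometric_fps_nth)
      also have "(fps_const 2 * geometric_fps) * (fps_const 2 * geometric_fps)
          = fps_const 4 * geometric_fps ^ 2"
      proof -
        have "fps_const (4 :: real) = fps_const 2 * fps_const 2" by simp
        then show ?thesis by (simp only: power2_eq_square mult_ac)
      qed
      finally show "fps_nth (kernel_fps_1 \<theta> * kernel_fps_half \<theta>) i
          \<le> fps_nth (fps_const 4 * geometric_fps ^ 2) i" .
    qed simp
    finally show ?thesis
      using geometric_fps_power_nth[of "2 * m + 1" n] by (simp add: D floor d)
  qed
  have "L_kernel l n (cos \<theta>) \<le> D_const l * (C_const ^ nat \<lfloor>l\<rfloor> / (B_coeff l n * sin (\<theta> / 2) ^ (d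
      + 1)))
               * real ((n + (d - 1)) choose n)" if \<theta>: "0 < \<theta>" "\<theta> \<le> pi" for \<theta>
  proof -
    have "sin (\<theta> / 2) ^ (d + 1) > 0"
      using \<theta> by (intro zero_less_power sin_gt_zero) auto
    then show ?thesis
      using sharp[OF \<theta>] B unfolding L by (simp add: field_simps)
  qed
  moreover have "L_kernel l n (cos \<theta>) \<le> 1 / B_coeff l n *
               (\<Sum>i=0..d+1.
                  real ((d + 1) choose i) * 2 ^ (d + 1 - i) * (- 1) ^ i
                    * real ((n + (2 * d - i)) choose n))" for \<theta>
  proof -
    \<comment> \<open>Only the inverse square root of A is replaced; the other factors have
      nonnegative coefficients.\<close>
    have "fps_majorized (F \<theta>) ((1 + fps_X) ^ (d + 1) * geometric_fps ^ (d + 1) * geometric_fps ^ d)"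
      unfolding F_def
      by (intro fps_majorized_mult fps_majorized_power quad_rsqrt_majorized fps_majorized_refl
          one_plus_fps_X_power_nth_nonneg fps_power_nonneg) (simp_all add: geometric_fps_nth)
    then have "fps_nth (F \<theta>) n \<le> fps_nth ((1 + fps_X) ^ (d + 1) * geometric_fps ^ (d
        + 1) * geometric_fps ^ d) n"
      by (rule fps_majorized_nthD)
    also have "(1 + fps_X) ^ (d + 1) * geometric_fps ^ (d + 1) * geometric_fps ^ d
       = (1 + fps_X) ^ (d + 1) * geometric_fps ^ Suc (2 * d)"
      by (simp only: Suc_eq_plus1 mult_2 mult_2_right power_add power_one_right mult_ac)
    finally show ?thesis
      unfolding L using B assms(1)
      by (subst one_plus_power_geometric_nth[symmetric]) (simp_all add: divide_right_mono)
  qed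
  ultimately show ?thesis by blast
qed

end
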